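(* Suppose $\alpha>0$, $\mathbf c=(c_1,c_2)\in\mathbb{C}^2$, $\mathbf w=(w_1,w_2)\in\mathbb{D}^2$ and $(\mathbf c,\mathbf w)\in\Lambda_\alpha\cup\Gamma$. Then \[ D_\alpha(\mathbf c,\mathbf w)\le0. \] Moreover, $D_\alpha(\mathbf c,\mathbf w)=0$ if and only if $c_1=0$, or $c_2=0$, or $w_1=w_2$.
   Context: $\mathrm{Log}$ is the branch of the logarithm on $\mathbb{C}\setminus(-\infty,0]$ with $\mathrm{Log}\,1=0$; powers use this branch; $\mathbb{H}=\{z\in\mathbb{C}:\mathrm{Re}\,z>0\}$; $\mathbb{D}$ is the open unit disc. For a positive integer $k$, $\mathbf c\in\mathbb{C}^k$, $\mathbf w\in\mathbb{D}^k$ and $\alpha>0$, let $\mathbf W_\alpha$ be the $k\times k$ matrix with $(i,j)$ entry $\frac{1}{(1-\overline{w_i}w_j)^\alpha}$, let $\mathbf f_\alpha=(f_{1,\alpha},\dots,f_{k,\alpha})=\mathbf c\mathbf W_\alpha$ ($\mathbf c$ a row vector), and let $N_\alpha=\mathbf c\mathbf W_\alpha\mathbf c^*=\sum_{i,j=1}^kc_i\overline{c_j}\frac{1}{(1-\overline{w_i}w_j)^\alpha}$. $\Lambda_\alpha$ is the set of pairs $(\mathbf c,\mathbf w)$ with $\mathbf c\in\mathbb{C}^k$, $\mathbf w\in(-1,1)^k$, $k$ a positive integer, and $f_{i,\alpha}\in\mathbb{H}$ for $i=1,\dots,k$. $\Gamma$ is the set of pairs $(\mathbf c,\mathbf w)$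 with $\mathbf c\in\mathbb{R}^k$, $\mathbf w\in(-1,1)^k$, $k$ a positive integer. For $(\mathbf c,\mathbf w)\in\Lambda_\alpha$, \[ D_\alpha(\mathbf c,\mathbf w)=\sum_{i,j=1}^kc_i\overline{c_j}\frac{1}{(1-\overline{w_i}w_j)^\alpha}\Big(\mathrm{Log}\,\overline{f_{i,\alpha}}+\mathrm{Log}\,f_{j,\alpha}+\alpha\,\mathrm{Log}(1-\overline{w_i}w_j)\Big)-N_\alpha\mathrm{Log}\,N_\alpha . \] For $(\mathbf c,\mathbf w)\in\Gamma$, \[ D_\alpha(\mathbf c,\mathbf w)=2\sum_{i=1}^kc_if_{i,\alpha}\mathrm{Log}|f_{i,\alpha}|+\sum_{i,j=1}^kc_ic_j\frac{1}{(1-w_iw_j)^\alpha}\mathrm{Log}(1-w_iw_j)^\alpha-N_\alpha\mathrm{Log}\,N_\alpha, \] with the convention $0\,\mathrm{Log}\,0=0$. The two formulas agree on $\Lambda_\alpha\cap\Gamma$. *)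

theory Defs
  imports "HOL-Analysis.Analysis" "HOL-Library.Complex_Order"
begin

text \<open>
  Vectors of \<open>\<complex>\<^sup>k\<close> have type \<open>complex ^ 'k\<close> with \<open>'k\<close> a finite type, so that \<open>k \<ge> 1\<close> holds automatically.
  The logarithm \<open>Log\<close> is \<open>Ln\<close>, and powers are \<open>powr\<close>; both are the principal branch off the
  nonpositive reals.  Since \<open>Ln 0 = 0\<close>, the convention \<open>0 Log 0 = 0\<close> holds for products.
  All quantities are complex-valued; \<open>\<le>\<close> on \<^typ>\<open>complex\<close> is the order of
  \<open>HOL-Library.Complex_Order\<close>, so \<open>z \<le> 0\<close> says that \<open>z\<close> is real and nonpositive.
\<close>

definition right_half_plane :: "complex set"
  where "right_half_plane = {z. Re z > 0}"

definition kernel_matrix :: "real \<Rightarrow> complex ^ 'k \<Rightarrow> complex ^ 'k ^ 'k"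
  where "kernel_matrix \<alpha> w = (\<chi> i j. 1 / (1 - cnj (w $ i) * w $ j) powr of_real \<alpha>)"

definition fvec :: "real \<Rightarrow> complex ^ 'k \<Rightarrow> complex ^ 'k \<Rightarrow> complex ^ 'k"
  where "fvec \<alpha> c w = c v* kernel_matrix \<alpha> w"

definition Nval :: "real \<Rightarrow> complex ^ 'k \<Rightarrow> complex ^ 'k \<Rightarrow> complex"
  where "Nval \<alpha> c w =
    (\<Sum>i\<in>UNIV. \<Sum>j\<in>UNIV. c $ i * cnj (c $ j) * (1 / (1 - cnj (w $ i) * w $ j) powr of_real \<alpha>))"

definition Lambda_set :: "real \<Rightarrow> ((complex ^ 'k) \<times> (complex ^ 'k)) set"
  where "Lambda_set \<alpha> =
    {(c, w). (\<forall>i. w $ i \<in> of_real ` {-1<..<1}) \<and> (\<forall>i. fvec \<alpha> c w $ i \<in> right_half_plane)}"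

definition Gamma_set :: "((complex ^ 'k) \<times> (complex ^ 'k)) set"
  where "Gamma_set = {(c, w). (\<forall>i. c $ i \<in> \<real>) \<and> (\<forall>i. w $ i \<in> of_real ` {-1<..<1})}"

definition D_Lambda :: "real \<Rightarrow> complex ^ 'k \<Rightarrow> complex ^ 'k \<Rightarrow> complex"
  where "D_Lambda \<alpha> c w =
    (\<Sum>i\<in>UNIV. \<Sum>j\<in>UNIV. c $ i * cnj (c $ j) * (1 / (1 - cnj (w $ i) * w $ j) powr of_real \<alpha>) *
       (Ln (cnj (fvec \<alpha> c w $ i)) + Ln (fvec \<alpha> c w $ j) + of_real \<alpha> * Ln (1 - cnj (w $ i) * w $ j)))
    - Nval \<alpha> c w * Ln (Nval \<alpha> c w)"

definition D_Gamma :: "real \<Rightarrow> complex ^ 'k \<Rightarrow> complex ^ 'k \<Rightarrow> complex"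
  where "D_Gamma \<alpha> c w =
    2 * (\<Sum>i\<in>UNIV. c $ i * fvec \<alpha> c w $ i * Ln (of_real (norm (fvec \<alpha> c w $ i))))
    + (\<Sum>i\<in>UNIV. \<Sum>j\<in>UNIV. c $ i * c $ j * (1 / (1 - w $ i * w $ j) powr of_real \<alpha>) *
         Ln ((1 - w $ i * w $ j) powr of_real \<alpha>))
    - Nval \<alpha> c w * Ln (Nval \<alpha> c w)"

text \<open>Only meaningful on \<open>Lambda_set \<alpha> \<union> Gamma_set\<close>; the order of the cases is irrelevant by
  \<open>D_Lambda_eq_D_Gamma\<close> below.\<close>

definition D :: "real \<Rightarrow> complex ^ 'k \<Rightarrow> complex ^ 'k \<Rightarrow> complex"
  where "D \<alpha> c w = (if (c, w) \<in> Lambda_set \<alpha> then D_Lambda \<alpha> c w else D_Gamma \<alpha> c w)"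

lemma D_Lambda_eq_D_Gamma:
  fixes c w :: "complex ^ 'k"
  assumes L: "(c, w) \<in> Lambda_set \<alpha>" and G: "(c, w) \<in> Gamma_set"
  shows "D_Lambda \<alpha> c w = D_Gamma \<alpha> c w"
proof -
  define K where "K i j = 1 / (1 - w $ i * w $ j) powr of_real \<alpha>" for i j
  define f where "f = fvec \<alpha> c w"
  have "\<forall>i. \<exists>r. w $ i = of_real r \<and> \<bar>r\<bar> < 1"
    using G by (force simp: Gamma_set_def)
  then obtain x where x: "\<And>i. w $ i = of_real (x i)" "\<And>i. \<bar>x i\<bar> < 1"
    by metis
  have cw: "cnj (w $ i) = w $ i" for i by (simp add: x)
  have cc: "cnj (c $ i) = c $ i" for i
    using G by (auto simp: Gamma_set_def Reals_cnj_iff)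
  have pos: "1 - x i * x j > 0" for i j
  proof -
    have "\<bar>x i * x j\<bar> < 1"
      unfolding abs_mult using x(2)[of i] x(2)[of j]
      by (metis abs_ge_zero mult_strict_mono' mult_1)
    then show ?thesis by linarith
  qed
  have base: "1 - w $ i * w $ j = of_real (1 - x i * x j)" for i j by (simp add: x)
  have K: "K i j = of_real (1 / (1 - x i * x j) powr \<alpha>)" for i j
    unfolding K_def base using pos[of i j] by (subst powr_of_real) auto
  have Ksym: "K i j = K j i" for i j by (simp add: K_def mult.commute)
  have LnK: "Ln ((1 - w $ i * w $ j) powr of_real \<alpha>) = of_real \<alpha> * Ln (1 - w $ i * w $ j)" for i j
    unfolding base using pos[of i j]
    by (subst powr_of_real) (auto simp: Ln_of_real ln_powr simp del: of_real_diff)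
  have f: "f $ j = (\<Sum>i\<in>UNIV. c $ i * K i j)" for j
    by (simp add: f_def fvec_def kernel_matrix_def vector_matrix_mult_def cw K_def)
  have cf: "cnj (f $ j) = f $ j" for j
    unfolding f by (simp add: cc K)
  have fpos: "Re (f $ j) > 0" for j
    using L by (auto simp: Lambda_set_def right_half_plane_def f_def)
  have nf: "of_real (norm (f $ j)) = f $ j" for j
  proof -
    have "Im (f $ j) = 0" using cf[of j] by (simp add: complex_eq_iff)
    then show ?thesis using fpos[of j] by (simp add: complex_eq_iff cmod_eq_Re)
  qed
  have A: "(\<Sum>i\<in>UNIV. \<Sum>j\<in>UNIV. c $ i * c $ j * K i j * Ln (f $ j)) = (\<Sum>j\<in>UNIV. c $ j * f $ j * Ln (f $ j))"
    unfolding f[of _] by (subst sum.swap)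
      (simp add: sum_distrib_left sum_distrib_right mult.assoc mult.commute mult.left_commute)
  have B: "(\<Sum>i\<in>UNIV. \<Sum>j\<in>UNIV. c $ i * c $ j * K i j * Ln (f $ i)) = (\<Sum>j\<in>UNIV. c $ j * f $ j * Ln (f $ j))"
    unfolding A[symmetric] by (subst sum.swap) (simp add: Ksym mult_ac)
  have "(\<Sum>i\<in>UNIV. \<Sum>j\<in>UNIV. c $ i * c $ j * K i j *
          (Ln (f $ i) + Ln (f $ j) + of_real \<alpha> * Ln (1 - w $ i * w $ j)))
      = 2 * (\<Sum>i\<in>UNIV. c $ i * f $ i * Ln (f $ i))
        + (\<Sum>i\<in>UNIV. \<Sum>j\<in>UNIV. c $ i * c $ j * K i j * (of_real \<alpha> * Ln (1 - w $ i * w $ j)))"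
    by (simp only: distrib_left sum.distrib A B mult_2)
  then show ?thesis
    unfolding D_Lambda_def D_Gamma_def f_def[symmetric] LnK cw cc cf nf K_def[symmetric] by simp
qed

end

theory Submission
  imports Defs
begin

text \<open>
  Write \<open>a\<close>, \<open>b\<close>, \<open>k\<close> for the diagonal and off-diagonal entries of the kernel matrix, and put
  \<open>A = a |c1|\<^sup>2\<close>, \<open>B = b |c2|\<^sup>2\<close>, \<open>z = k c1 cnj c2\<close> and \<open>N = A + B + 2 Re z\<close>, the sum of the four entries
  of the table with rows \<open>(A, z)\<close> and \<open>(cnj z, B)\<close>.  The quantity \<open>D\<close> depends on the table alone:
  on both \<open>Lambda_set\<close> and \<open>Gamma_set\<close> it equals
  \<open>2 Re ((A + z) Log (A + z) + (B + z) Log (B + z) - z Log z) - A ln A - B ln B - N ln N\<close>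
  (\<open>D_eq_neg_information\<close>).  For \<open>c1, c2 > 0\<close> this is \<open>-N\<close> times the mutual information of the table
  regarded as a joint distribution, and mutual information is nonnegative and vanishes exactly when
  the table has rank one.  The same turns out to be true for complex \<open>z\<close> with \<open>|z|\<^sup>2 \<le> A B\<close>.

  The Cauchy-Schwarz inequality \<open>k\<^sup>2 \<le> a b\<close>, strict unless \<open>w1 = w2\<close>, says that \<open>|z|\<^sup>2 \<le> A B\<close>, with equality
  exactly when \<open>c1 = 0\<close>, \<open>c2 = 0\<close> or \<open>w1 = w2\<close>.  On the circle \<open>|z|\<^sup>2 = A B\<close> the expression vanishes
  (\<open>neg_information_circle_upper\<close>).  It is invariant under conjugation, so let \<open>Im z \<ge> 0\<close>.  When \<open>z\<close>
  moves up along a vertical line, \<open>N\<close> stays fixed, and \<open>Re (z Log z)\<close> has derivative \<open>-Arg z\<close>.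
  The expression therefore changes at the rate \<open>2 (Arg z - Arg (A + z) - Arg (B + z))\<close>, which is twice
  the argument of \<open>z cnj (A + z) cnj (B + z)\<close>.  The imaginary part of this product is
  \<open>Im z (A B - |z|\<^sup>2)\<close>, which is positive inside the circle.  So the expression increases strictly to
  its value \<open>0\<close> on the circle, and it is negative inside (\<open>neg_information_inside_upper\<close>).  This
  argument includes real \<open>z\<close> of either sign, because \<open>Re (z Log z)\<close> is continuous up to the real axis.
\<close>

section \<open>The real part of z Log z on the closed upper half-plane\<close>

lemma Arg_times_cnj:
  assumes "z \<noteq> 0" "w \<noteq> 0" "Arg z - Arg w \<in> {-pi<..pi}"
  shows "Arg (z * cnj w) = Arg z - Arg w"
proof -
  have w: "cnj w = rcis (norm w) (- Arg w)"
    by (metis rcis_cmod_Arg rcis_def cis_cnj complex_cnj_complex_of_real complex_cnj_mult)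
  have "z * cnj w = rcis (norm z * norm w) (Arg z - Arg w)"
    by (metis w rcis_cmod_Arg rcis_mult diff_conv_add_uminus)
  then show ?thesis
    using assms by (metis Arg_rcis mult_pos_pos zero_less_norm_iff)
qed

lemma Re_mult_Ln: "Re (z * Ln z) = Re z * ln (norm z) - Im z * Arg z"
  by (cases "z = 0") (simp_all add: Arg_eq_Im_Ln)

lemma Re_cnj_mult_Ln_cnj: "Re (cnj z * Ln (cnj z)) = Re (z * Ln z)"
  by (simp add: Re_mult_Ln Arg_cnj complex_is_Real_iff del: times_complex.sel)

text \<open>
  The function \<open>z Log z\<close> has derivative \<open>Log z + 1\<close>; moving in the direction \<open>\<i>\<close> turns the
  real part of the increment into minus the imaginary part of \<open>Log z + 1\<close>.
\<close>

lemma Re_mult_Ln_vertical_derivative: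
  fixes t y :: real
  assumes "y > 0"
  shows "((\<lambda>y. Re (Complex t y * Ln (Complex t y))) has_real_derivative
           - Arg (Complex t y)) (at y)"
proof -
  have ne: "Complex t y \<notin> \<real>\<^sub>\<le>\<^sub>0" and nz: "Complex t y \<noteq> 0"
    using assms by (auto simp: complex_nonpos_Reals_iff complex_eq_iff)
  have line: "((\<lambda>y. Complex t y) has_vector_derivative \<i>) (at y)"
  proof -
    have "((\<lambda>y. of_real t + of_real y * \<i>) has_vector_derivative \<i>) (at y)"
      by (auto intro!: derivative_eq_intros simp: has_vector_derivative_def scaleR_conv_of_real)
    then show ?thesis by (simp add: complex_eq_iff Complex_eq mult.commute)
  qed
  have "((\<lambda>z. z * Ln z) has_field_derivative Ln (Complex t y) + 1) (at (Complex t y))"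
    using ne nz by (auto intro!: derivative_eq_intros)
  from field_vector_diff_chain_at[OF line this]
  have "((\<lambda>y. Complex t y * Ln (Complex t y)) has_vector_derivative
          \<i> * (Ln (Complex t y) + 1)) (at y)"
    by (simp add: o_def)
  from bounded_linear.has_vector_derivative[OF bounded_linear_Re this]
  show ?thesis
    using nz by (simp add: has_real_derivative_iff_has_vector_derivative Arg_eq_Im_Ln)
qed

text \<open>
  The logarithm jumps across the negative axis and is singular at the origin, but neither defect is
  visible from above in the real part \<open>Re z ln |z| - Im z Arg z\<close>: the argument is multiplied by
  \<open>Im z\<close>, and on a vertical line the first term is either identically zero or away from the
  singularity of \<open>ln\<close>.
\<close>

lemma Re_mult_Ln_vertical_continuous:
  fixes t :: real
  shows "continuous_on {0..} (\<lambda>y. Re (Complex t y * Ln (Complex t y)))" (is "continuous_on _ ?h")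
proof -
  have "continuous (at y within {0..}) ?h" if "y > 0" for y
    using DERIV_isCont[OF Re_mult_Ln_vertical_derivative[OF that, of t]]
    by (rule continuous_at_imp_continuous_at_within)
  moreover have "continuous (at 0 within {0..}) ?h"
  proof -
    have log: "((\<lambda>y. t * ln (norm (Complex t y))) \<longlongrightarrow> t * ln \<bar>t\<bar>) (at 0 within {0..})"
    proof (cases "t = 0")
      case False
      have "((\<lambda>y. Complex t y) \<longlongrightarrow> Complex t 0) (at 0 within {0..})"
        by (intro tendsto_Complex tendsto_const tendsto_ident_at)
      then have "((\<lambda>y. t * ln (norm (Complex t y))) \<longlongrightarrow> t * ln (norm (Complex t 0))) (at 0 within {0..})"
        using False by (intro tendsto_mult tendsto_const tendsto_ln tendsto_norm) (auto simp: complex_eq_iff)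
      then show ?thesis by (simp add: complex_norm)
    qed simp
    have arg: "((\<lambda>y. y * Arg (Complex t y)) \<longlongrightarrow> 0) (at 0 within {0..})"
    proof (rule Lim_null_comparison)
      have "norm (y * Arg (Complex t y)) \<le> \<bar>y\<bar> * pi" for y
        using mpi_less_Arg[of "Complex t y"] Arg_le_pi[of "Complex t y"]
        unfolding real_norm_def abs_mult by (intro mult_left_mono) auto
      then show "\<forall>\<^sub>F y in at 0 within {0..}. norm (y * Arg (Complex t y)) \<le> \<bar>y\<bar> * pi"
        by simp
      show "((\<lambda>y. \<bar>y\<bar> * pi) \<longlongrightarrow> 0) (at 0 within {0..})"
        by (intro tendsto_mult_left_zero tendsto_rabs_zero tendsto_ident_at)
    qed
    have "?h y = t * ln (norm (Complex t y)) - y * Arg (Complex t y)" for y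
      using Re_mult_Ln[of "Complex t y"] by (simp only: complex.sel)
    then show ?thesis
      using tendsto_diff[OF log arg] unfolding continuous_within
      by (simp add: complex_norm del: times_complex.sel)
  qed
  ultimately show ?thesis
    unfolding continuous_on_eq_continuous_within by (metis atLeast_iff order_less_le)
qed

text \<open>
  All three arguments lie in \<open>(0, \<pi>)\<close>, so their combination could leave the principal range only
  from below.  It does not, since adding a nonnegative real number decreases the argument.
\<close>

lemma Arg_mult_cnj_shifts:
  fixes A B :: real and z :: complex
  assumes "A \<ge> 0" "B \<ge> 0" "Im z > 0"
  shows "Arg (z * cnj (A + z) * cnj (B + z)) = Arg z - Arg (A + z) - Arg (B + z)"
proof -
  have rng: "0 < Arg (of_real r + z)" "Arg (of_real r + z) < pi" for r :: real
    using Arg_lt_pi[of "of_real r + z"] assms by auto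
  have nz: "of_real r + z \<noteq> 0" for r :: real
    using assms by (auto simp: complex_eq_iff)
  have 1: "Arg (z * cnj (A + z)) = Arg z - Arg (A + z)"
    using rng[of 0] rng[of A] nz[of 0] nz[of A] by (intro Arg_times_cnj) auto
  have "Im (z * cnj (A + z)) = A * Im z" by (simp add: algebra_simps)
  then have "0 \<le> Arg (z * cnj (A + z))" using assms by (simp add: Arg_less_0)
  then have "Arg (z * cnj (A + z)) - Arg (B + z) \<in> {-pi<..pi}"
    using rng[of A] rng[of B] rng[of 0] unfolding 1 by simp
  moreover have "z * cnj (A + z) \<noteq> 0"
    using nz[of 0] nz[of A] by (metis add_0 complex_cnj_zero_iff mult_eq_0_iff of_real_0)
  ultimately show ?thesis
    using Arg_times_cnj[of "z * cnj (A + z)" "B + z"] nz[of B] 1 by simp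
qed

text \<open>
  The imaginary part shows where the circle \<open>|z|\<^sup>2 = A B\<close> comes from: in the upper half-plane, it is
  there that the phase of this product changes sign.
\<close>

lemma mult_cnj_shifts:
  fixes A B :: real and z :: complex
  shows "z * cnj (A + z) * cnj (B + z) = Complex
    (Re z * (A * B + (norm z)\<^sup>2) + (A + B) * (norm z)\<^sup>2) (Im z * (A * B - (norm z)\<^sup>2))"
  unfolding cmod_power2 by (simp add: complex_eq_iff power2_eq_square algebra_simps)

section \<open>Mutual information of a complex two by two table\<close>

text \<open>
  Consider the table with rows \<open>(A, z)\<close> and \<open>(cnj z, B)\<close> and total mass \<open>N\<close>.  If \<open>A\<close>, \<open>B\<close>
  and \<open>z\<close> are positive, dividing by \<open>N\<close> gives a joint probability distribution with both marginals proportional to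
  \<open>(A + z, B + z)\<close>, and the value below is \<open>-N\<close> times its mutual information.
\<close>

definition neg_information :: "real \<Rightarrow> real \<Rightarrow> complex \<Rightarrow> real"
  where "neg_information A B z =
    2 * Re ((A + z) * Ln (A + z)) + 2 * Re ((B + z) * Ln (B + z)) - 2 * Re (z * Ln z)
    - A * ln A - B * ln B - (A + B + 2 * Re z) * ln (A + B + 2 * Re z)"

lemma neg_information_cnj: "neg_information A B (cnj z) = neg_information A B z"
  using Re_cnj_mult_Ln_cnj[of z] Re_cnj_mult_Ln_cnj[of "A + z"] Re_cnj_mult_Ln_cnj[of "B + z"]
  unfolding neg_information_def by simp

lemma geometric_mean_bound:
  fixes A B x :: real
  assumes "A \<ge> 0" "B \<ge> 0" "x\<^sup>2 \<le> A * B"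
  shows "A + B + 2 * x \<ge> 0"
proof -
  have "\<bar>x\<bar> \<le> sqrt (A * B)" using assms by (metis real_sqrt_abs real_sqrt_le_mono)
  also have "\<dots> \<le> (A + B) / 2" using arith_geo_mean_sqrt assms by blast
  finally show ?thesis using abs_ge_minus_self[of x] by (simp add: field_simps)
qed

text \<open>
  When \<open>|z|\<^sup>2 = A B\<close> the table has rank one.  Then \<open>|A + z|\<^sup>2 = A N\<close> and \<open>|B + z|\<^sup>2 = B N\<close>, so all
  logarithms of moduli split into \<open>ln A\<close>, \<open>ln B\<close>, \<open>ln N\<close> and cancel; the phases cancel because
  \<open>z cnj (A + z) cnj (B + z)\<close> is the nonnegative real number \<open>A B N\<close>.
\<close>

lemma neg_information_circle_upper:
  assumes AB: "A \<ge> 0" "B \<ge> 0" and circ: "(norm z)\<^sup>2 = A * B" and im: "Im z \<ge> 0"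
  shows "neg_information A B z = 0"
proof (cases "A = 0 \<or> B = 0")
  case True
  then have "z = 0" using circ by auto
  with True AB show ?thesis by (auto simp: neg_information_def Ln_of_real Re_mult_Ln simp del: times_complex.sel)
next
  case False
  then have pos: "A > 0" "B > 0" using AB by auto
  define N where "N = A + B + 2 * Re z"
  have nA: "(norm (A + z))\<^sup>2 = A * N" and nB: "(norm (B + z))\<^sup>2 = B * N"
    using circ unfolding cmod_power2 N_def by (simp_all add: power2_eq_square algebra_simps)
  have "(Re z)\<^sup>2 \<le> A * B" using circ by (simp add: cmod_power2 flip: circ)
  then have "N \<ge> 0" unfolding N_def using geometric_mean_bound AB by simp
  have lz: "2 * ln (norm z) = ln A + ln B"
    using pos circ by (metis ln_mult_pos ln_realpow of_nat_numeral)
  have phase: "Im z * (Arg z - Arg (A + z) - Arg (B + z)) = 0"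
  proof (cases "Im z = 0")
    case False
    then have "Im z > 0" using im by simp
    have "z * cnj (A + z) * cnj (B + z) = of_real (A * B * N)"
      unfolding mult_cnj_shifts circ N_def by (simp add: complex_eq_iff algebra_simps)
    then have "Arg (z * cnj (A + z) * cnj (B + z)) = 0"
      using AB \<open>N \<ge> 0\<close> by (simp only: Arg_of_real) (simp add: not_less)
    then show ?thesis using Arg_mult_cnj_shifts[OF AB \<open>Im z > 0\<close>] by simp
  qed simp
  have log_sum: "2 * (s + Re z) * ln (norm (s + z)) = (s + Re z) * (ln s + ln N)"
    if "s > 0" and ns: "(norm (s + z))\<^sup>2 = s * N" for s :: real
  proof (cases "s + z = 0")
    case True
    then show ?thesis by (simp add: complex_eq_iff)
  next
    case False
    then have "N > 0" using ns \<open>N \<ge> 0\<close> by (metis mult_zero_right norm_eq_zero order_less_le zero_eq_power2)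
    have "2 * ln (norm (s + z)) = ln ((norm (s + z))\<^sup>2)" using False by (simp add: ln_realpow)
    also have "\<dots> = ln s + ln N" unfolding ns using \<open>s > 0\<close> \<open>N > 0\<close> by (simp add: ln_mult_pos)
    finally have "2 * ln (norm (s + z)) = ln s + ln N" .
    then show ?thesis by (metis mult.assoc mult.commute)
  qed
  have "neg_information A B z = 2 * (A + Re z) * ln (norm (A + z)) + 2 * (B + Re z) * ln (norm (B + z))
     - Re z * (2 * ln (norm z)) + 2 * (Im z * (Arg z - Arg (A + z) - Arg (B + z)))
     - A * ln A - B * ln B - N * ln N"
    unfolding neg_information_def Re_mult_Ln N_def by (simp add: algebra_simps)
  then show ?thesis
    unfolding log_sum[OF pos(1) nA] log_sum[OF pos(2) nB] lz phase by (simp add: N_def algebra_simps)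
qed

text \<open>
  On a vertical line the total mass is constant, so by the derivative of \<open>Re (z Log z)\<close> this
  quantity changes at the rate \<open>2 (Arg z - Arg (A + z) - Arg (B + z))\<close>.  This is positive as long
  as \<open>|z|\<^sup>2 < A B\<close>, hence the value at \<open>z\<close> is smaller than the value \<open>0\<close> at the point of the
  circle above it.
\<close>

lemma neg_information_inside_upper:
  assumes AB: "A > 0" "B > 0" and ins: "(norm z)\<^sup>2 < A * B" and im: "Im z \<ge> 0"
  shows "neg_information A B z < 0"
proof -
  define x where "x = Re z"
  \<comment> \<open>height at which the vertical line through \<open>z\<close> meets the circle\<close>
  define r where "r = sqrt (A * B - x\<^sup>2)"
  define g where "g t y = Re (Complex t y * Ln (Complex t y))" for t y
  define F where "F y = neg_information A B (Complex x y)" for y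
  have F: "F y = 2 * g (A + x) y + 2 * g (B + x) y - 2 * g x y
      - A * ln A - B * ln B - (A + B + 2 * x) * ln (A + B + 2 * x)" for y
  proof -
    have "complex_of_real s + Complex x y = Complex (s + x) y" for s
      by (simp add: complex_eq_iff)
    then show ?thesis unfolding F_def neg_information_def g_def by simp
  qed
  have ins': "x\<^sup>2 + (Im z)\<^sup>2 < A * B" using ins by (simp add: cmod_power2 x_def)
  then have r2: "r\<^sup>2 = A * B - x\<^sup>2"
    unfolding r_def by (smt (verit) real_sqrt_pow2 zero_le_power2)
  have yr: "Im z < r" unfolding r_def using ins' im by (intro real_less_rsqrt) auto
  have "F (Im z) < F r"
  proof (rule DERIV_pos_imp_increasing_open[OF yr])
    fix y assume y: "Im z < y" "y < r"
    then have "y > 0" using im by simp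
    let ?\<zeta> = "Complex x y"
    define \<psi> where "\<psi> = Arg ?\<zeta> - Arg (Complex (A + x) y) - Arg (Complex (B + x) y)"
    have g_deriv: "(g t has_real_derivative - Arg (Complex t y)) (at y)" for t
      unfolding g_def by (rule Re_mult_Ln_vertical_derivative[OF \<open>y > 0\<close>])
    have "(F has_real_derivative 2 * \<psi>) (at y)"
      unfolding F \<psi>_def
      by (rule g_deriv derivative_eq_intros refl | simp)+
    moreover have "\<psi> > 0"
    proof -
      have "y\<^sup>2 < r\<^sup>2" using \<open>y > 0\<close> y by (intro power_strict_mono) auto
      then have "(norm ?\<zeta>)\<^sup>2 < A * B" using r2 by (simp add: cmod_power2)
      then have "Im (?\<zeta> * cnj (A + ?\<zeta>) * cnj (B + ?\<zeta>)) > 0"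
        using \<open>y > 0\<close> by (simp only: mult_cnj_shifts complex.sel) simp
      then have "Arg (?\<zeta> * cnj (A + ?\<zeta>) * cnj (B + ?\<zeta>)) > 0"
        using Arg_pos_iff by blast
      moreover have "complex_of_real s + ?\<zeta> = Complex (s + x) y" for s
        by (simp add: complex_eq_iff)
      ultimately show ?thesis
        using Arg_mult_cnj_shifts[of A B ?\<zeta>] AB \<open>y > 0\<close> by (simp add: \<psi>_def)
    qed
    ultimately show "\<exists>d. (F has_real_derivative d) (at y) \<and> d > 0"
      by (intro exI[of _ "2 * \<psi>"]) auto
  next
    have "continuous_on {0..} F"
      unfolding F g_def by (intro continuous_intros Re_mult_Ln_vertical_continuous)
    then show "continuous_on {Im z..r} F"
      by (rule continuous_on_subset) (use im in auto)
  qed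
  also have "F r = 0"
    unfolding F_def using AB r2 yr im
    by (intro neg_information_circle_upper) (auto simp: cmod_power2)
  finally show ?thesis by (simp add: F_def x_def)
qed

lemma neg_information_sign:
  assumes AB: "A \<ge> 0" "B \<ge> 0" and disc: "(norm z)\<^sup>2 \<le> A * B"
  shows "neg_information A B z \<le> 0"
    and "neg_information A B z = 0 \<longleftrightarrow> (norm z)\<^sup>2 = A * B"
proof -
  define \<zeta> where "\<zeta> = (if Im z \<ge> 0 then z else cnj z)"
  have \<zeta>: "Im \<zeta> \<ge> 0" "norm \<zeta> = norm z" "neg_information A B \<zeta> = neg_information A B z"
    by (auto simp: \<zeta>_def neg_information_cnj)
  have eq: "neg_information A B z = 0" if "(norm z)\<^sup>2 = A * B"
    using neg_information_circle_upper[OF AB] \<zeta> that by metis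
  have less: "neg_information A B z < 0" if *: "(norm z)\<^sup>2 < A * B"
  proof -
    have "0 < A * B" using * by (smt (verit) zero_le_power2)
    then have "A > 0" "B > 0" using AB by (auto simp: zero_less_mult_iff)
    then show ?thesis using neg_information_inside_upper \<zeta> that by metis
  qed
  show "neg_information A B z \<le> 0"
    using eq less disc by (cases "(norm z)\<^sup>2 = A * B") auto
  show "neg_information A B z = 0 \<longleftrightarrow> (norm z)\<^sup>2 = A * B"
    using eq less disc by (metis order_less_le)
qed

section \<open>From coefficient pairs to tables\<close>

text \<open>
  Both sides are the argument of \<open>f1 cnj f2\<close>, because \<open>|z|\<^sup>2 f1 cnj f2\<close> is \<open>k\<close> times the product
  \<open>z cnj (A + z) cnj (B + z)\<close>.  The half-plane condition keeps \<open>Arg f1 - Arg f2\<close> inside \<open>(-\<pi>, \<pi>)\<close>,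
  so that no multiple of \<open>2\<pi>\<close> intervenes.
\<close>

lemma Arg_diff_upper:
  fixes a b k :: real and c1 c2 :: complex
  assumes pos: "a \<ge> 0" "b \<ge> 0" "k > 0"
    and f1: "f1 = a * c1 + k * c2" and f2: "f2 = k * c1 + b * c2"
    and half: "Re f1 > 0" "Re f2 > 0"
    and z: "z = k * c1 * cnj c2" and up: "Im z > 0"
  shows "Arg f1 - Arg f2 = Arg z - Arg (of_real (a * (norm c1)\<^sup>2) + z) - Arg (of_real (b * (norm c2)\<^sup>2) + z)"
proof -
  have nz: "f1 \<noteq> 0" "f2 \<noteq> 0" "z \<noteq> 0" using half up by auto
  have rng: "\<bar>Arg f\<bar> < pi / 2" if "Re f > 0" for f
    using Re_Ln_pos_lt_imp[OF that] that by (cases "f = 0") (auto simp: Arg_eq_Im_Ln)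
  have "Arg f1 - Arg f2 \<in> {-pi<..pi}" using rng[OF half(1)] rng[OF half(2)] by auto
  then have "Arg f1 - Arg f2 = Arg (f1 * cnj f2)" using nz by (simp add: Arg_times_cnj)
  also have "\<dots> = Arg (of_real ((norm z)\<^sup>2 / k) * (f1 * cnj f2))"
    using nz pos by (subst Arg_times_of_real) auto
  also have "of_real ((norm z)\<^sup>2 / k) * (f1 * cnj f2) =
    z * cnj (of_real (a * (norm c1)\<^sup>2) + z) * cnj (of_real (b * (norm c2)\<^sup>2) + z)"
  proof -
    have "of_real ((norm z)\<^sup>2 / k) = z * (c2 * cnj c1)"
    proof -
      have "of_real ((norm z)\<^sup>2) = z * (k * (c2 * cnj c1))"
        unfolding complex_norm_square by (simp add: z)
      then show ?thesis using pos by (simp add: field_simps)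
    qed
    moreover have "cnj c1 * f1 = cnj (of_real (a * (norm c1)\<^sup>2) + z)"
      unfolding f1 z by (simp add: complex_norm_square algebra_simps del: of_real_power)
    moreover have "c2 * cnj f2 = cnj (of_real (b * (norm c2)\<^sup>2) + z)"
      unfolding f2 z by (simp add: complex_norm_square algebra_simps del: of_real_power)
    ultimately show ?thesis by (metis mult.assoc mult.left_commute)
  qed
  also have "Arg \<dots> = Arg z - Arg (of_real (a * (norm c1)\<^sup>2) + z) - Arg (of_real (b * (norm c2)\<^sup>2) + z)"
    by (rule Arg_mult_cnj_shifts) (use pos up in auto)
  finally show ?thesis .
qed

text \<open>
  Exchanging the two indices conjugates \<open>z\<close>, which reduces the lower half-plane to the upper one.
\<close>

lemma Im_times_Arg_diff:
  fixes a b k :: real and c1 c2 :: complex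
  assumes pos: "a \<ge> 0" "b \<ge> 0" "k > 0"
    and f1: "f1 = a * c1 + k * c2" and f2: "f2 = k * c1 + b * c2"
    and half: "Re f1 > 0" "Re f2 > 0"
    and z: "z = k * c1 * cnj c2"
  shows "Im z * (Arg f1 - Arg f2) =
    Im z * (Arg z - Arg (of_real (a * (norm c1)\<^sup>2) + z) - Arg (of_real (b * (norm c2)\<^sup>2) + z))"
proof (cases "Im z" "0::real" rule: linorder_cases)
  case greater
  then show ?thesis using Arg_diff_upper[OF assms] by simp
next
  case less
  have "Arg f2 - Arg f1 = Arg (cnj z)
      - Arg (of_real (b * (norm c2)\<^sup>2) + cnj z) - Arg (of_real (a * (norm c1)\<^sup>2) + cnj z)"
    by (rule Arg_diff_upper[of b a k _ c2 c1]) (use assms less in \<open>auto simp: algebra_simps\<close>)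
  moreover have "Arg (of_real r + cnj z) = - Arg (of_real r + z)" for r :: real
    using Arg_cnj[of "of_real r + z"] less by (simp add: complex_is_Real_iff)
  from this this[of 0] have "Arg (of_real r + cnj z) = - Arg (of_real r + z)" "Arg (cnj z) = - Arg z" for r :: real
    by simp_all
  ultimately show ?thesis by (simp del: of_real_mult of_real_power)
qed simp

text \<open>
  Since \<open>|A + z| = |c1| |f1|\<close>, \<open>|B + z| = |c2| |f2|\<close> and \<open>|z| = k |c1| |c2|\<close>, every logarithm on the
  left other than the one of the total mass splits, and the terms in \<open>ln |c1|\<close> and \<open>ln |c2|\<close> cancel.  A logarithm whose argument
  vanishes is always multiplied by zero.
\<close>

lemma neg_information_of_pair:
  fixes a b k :: real and c1 c2 :: complex
  assumes pos: "a > 0" "b > 0" "k > 0"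
    and f1: "f1 = a * c1 + k * c2" and f2: "f2 = k * c1 + b * c2"
    and z: "z = k * c1 * cnj c2" and A: "A = a * (norm c1)\<^sup>2" and B: "B = b * (norm c2)\<^sup>2"
  shows "neg_information A B z =
      2 * (A + Re z) * ln (norm f1) + 2 * (B + Re z) * ln (norm f2)
      + 2 * (Im z * (Arg z - Arg (A + z) - Arg (B + z)))
      - A * ln a - B * ln b - 2 * Re z * ln k - (A + B + 2 * Re z) * ln (A + B + 2 * Re z)"
proof -
  have "cnj (A + z) = cnj c1 * f1" and "B + z = cnj c2 * f2"
    unfolding A B f1 f2 z by (simp_all add: complex_norm_square algebra_simps del: of_real_power)
  then have nA: "norm (A + z) = norm c1 * norm f1" and nB: "norm (B + z) = norm c2 * norm f2"
    by (metis complex_mod_cnj norm_mult)+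
  have lA: "(A + Re z) * ln (norm (A + z)) = (A + Re z) * (ln (norm c1) + ln (norm f1))"
  proof (cases "A + z = 0")
    case True
    then show ?thesis by (simp add: complex_eq_iff)
  next
    case False
    then have "norm c1 \<noteq> 0" "norm f1 \<noteq> 0" using nA by auto
    then show ?thesis unfolding nA by (simp add: ln_mult_pos)
  qed
  have lB: "(B + Re z) * ln (norm (B + z)) = (B + Re z) * (ln (norm c2) + ln (norm f2))"
  proof (cases "B + z = 0")
    case True
    then show ?thesis by (simp add: complex_eq_iff)
  next
    case False
    then have "norm c2 \<noteq> 0" "norm f2 \<noteq> 0" using nB by auto
    then show ?thesis unfolding nB by (simp add: ln_mult_pos)
  qed
  have lz: "Re z * ln (norm z) = Re z * (ln k + ln (norm c1) + ln (norm c2))"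
  proof (cases "c1 = 0 \<or> c2 = 0")
    case True
    then show ?thesis by (auto simp: z)
  next
    case False
    then show ?thesis using pos unfolding z norm_mult by (simp add: ln_mult_pos)
  qed
  have log_mass: "r * (norm c)\<^sup>2 * ln (r * (norm c)\<^sup>2) = r * (norm c)\<^sup>2 * (ln r + 2 * ln (norm c))"
    if "r > 0" for r and c :: complex
    using that by (cases "c = 0") (simp_all add: ln_mult_pos ln_realpow)
  have "A * ln A = A * (ln a + 2 * ln (norm c1))" "B * ln B = B * (ln b + 2 * ln (norm c2))"
    unfolding A B using log_mass pos by blast+
  moreover have "neg_information A B z =
      2 * ((A + Re z) * ln (norm (A + z))) + 2 * ((B + Re z) * ln (norm (B + z)))
      - 2 * (Re z * ln (norm z)) + 2 * (Im z * (Arg z - Arg (A + z) - Arg (B + z)))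
      - A * ln A - B * ln B - (A + B + 2 * Re z) * ln (A + B + 2 * Re z)"
    unfolding neg_information_def Re_mult_Ln by (simp add: algebra_simps)
  ultimately show ?thesis unfolding lA lB lz by (simp add: algebra_simps)
qed

section \<open>The kernel on the real diameter\<close>

definition real_kernel :: "real \<Rightarrow> real \<Rightarrow> real \<Rightarrow> real"
  where "real_kernel \<alpha> s t = (1 - s * t) powr (- \<alpha>)"

context
  fixes s t :: real
  assumes st: "s \<in> {-1<..<1}" "t \<in> {-1<..<1}"
begin

lemma one_minus_mult_pos: "1 - s * t > 0"
proof -
  have "\<bar>s\<bar> * \<bar>t\<bar> < 1 * 1" using st by (intro mult_strict_mono') auto
  then show ?thesis by (simp flip: abs_mult)
qed

lemma real_kernel_pos: "real_kernel \<alpha> s t > 0"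
  using one_minus_mult_pos by (simp add: real_kernel_def)

lemma powr_eq_real_kernel:
  "(1 - of_real s * of_real t) powr complex_of_real \<alpha> = of_real (1 / real_kernel \<alpha> s t)"
proof -
  have "(1 - of_real s * of_real t) powr complex_of_real \<alpha> = of_real (1 - s * t) powr complex_of_real \<alpha>"
    by simp
  also have "\<dots> = of_real ((1 - s * t) powr \<alpha>)"
    using one_minus_mult_pos by (subst powr_of_real) auto
  finally show ?thesis by (simp add: real_kernel_def powr_minus_divide)
qed

lemma Ln_eq_ln_real_kernel:
  "complex_of_real \<alpha> * Ln (1 - of_real s * of_real t) = - of_real (ln (real_kernel \<alpha> s t))"
proof -
  have "Ln (1 - of_real s * of_real t) = of_real (ln (1 - s * t))"
    using one_minus_mult_pos by (subst Ln_of_real[symmetric]) auto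
  then show ?thesis
    using one_minus_mult_pos by (simp add: real_kernel_def ln_powr)
qed

end

lemma real_kernel_commute: "real_kernel \<alpha> s t = real_kernel \<alpha> t s"
  by (simp add: real_kernel_def mult.commute)

text \<open>
  The two sides are the powers with exponent \<open>-\<alpha>\<close> of \<open>(1 - s t)\<^sup>2\<close> and \<open>(1 - s\<^sup>2) (1 - t\<^sup>2)\<close>, whose
  difference is \<open>(s - t)\<^sup>2\<close>.
\<close>

lemma real_kernel_Cauchy_Schwarz:
  assumes "\<alpha> > 0" and st: "s \<in> {-1<..<1}" "t \<in> {-1<..<1}"
  shows "(real_kernel \<alpha> s t)\<^sup>2 \<le> real_kernel \<alpha> s s * real_kernel \<alpha> t t"
    and "(real_kernel \<alpha> s t)\<^sup>2 = real_kernel \<alpha> s s * real_kernel \<alpha> t t \<longleftrightarrow> s = t"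
proof -
  let ?p = "(1 - s * s) * (1 - t * t)" and ?q = "(1 - s * t)\<^sup>2"
  have pos: "1 - s * s > 0" "1 - t * t > 0" "1 - s * t > 0"
    using one_minus_mult_pos st by auto
  have gap: "?q - ?p = (s - t)\<^sup>2" by (simp add: power2_eq_square algebra_simps)
  have q: "(real_kernel \<alpha> s t)\<^sup>2 = ?q powr (- \<alpha>)"
    using pos unfolding real_kernel_def power2_eq_square by (simp add: powr_mult)
  have p: "real_kernel \<alpha> s s * real_kernel \<alpha> t t = ?p powr (- \<alpha>)"
    using pos unfolding real_kernel_def by (simp add: powr_mult)
  have less: "(real_kernel \<alpha> s t)\<^sup>2 < real_kernel \<alpha> s s * real_kernel \<alpha> t t" if "s \<noteq> t"
  proof -
    have "(s - t)\<^sup>2 > 0" using that by simp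
    then have "?p < ?q" using gap by linarith
    then show ?thesis unfolding p q using \<open>\<alpha> > 0\<close> pos by (intro powr_less_mono2_neg) auto
  qed
  have eq: "(real_kernel \<alpha> s t)\<^sup>2 = real_kernel \<alpha> s s * real_kernel \<alpha> t t" if "s = t"
    using that by (simp add: power2_eq_square)
  show "(real_kernel \<alpha> s t)\<^sup>2 \<le> real_kernel \<alpha> s s * real_kernel \<alpha> t t"
    using less eq by (cases "s = t") auto
  show "(real_kernel \<alpha> s t)\<^sup>2 = real_kernel \<alpha> s s * real_kernel \<alpha> t t \<longleftrightarrow> s = t"
    using less eq by (metis order_less_irrefl)
qed

section \<open>The sign of D for two points\<close>

lemma Ln_one_divide_of_real:
  assumes "x > 0"
  shows "Ln (1 / of_real x) = - of_real (ln x)"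
  using assms Ln_of_real[of "1 / x"] by (simp add: ln_div)

lemma of_real_mult_Ln: "x \<ge> 0 \<Longrightarrow> of_real x * Ln (of_real x) = of_real (x * ln x)"
  by (cases "x = 0") (simp_all add: Ln_of_real)

text \<open>
  Summing over rows and columns gives \<open>cnj c1 f1 = A + cnj z\<close> and \<open>cnj c2 f2 = B + z\<close>, so that only
  the phases of \<open>f1\<close> and \<open>f2\<close> need care.  On \<open>Lambda_set\<close> they contribute
  \<open>2 Im z (Arg f1 - Arg f2)\<close>; on \<open>Gamma_set\<close> the number \<open>z\<close> is real and the phase term of the
  information is zero, in agreement with the absolute values in \<open>D_Gamma\<close>.
\<close>

lemma D_eq_neg_information:
  fixes c w :: "complex ^ 2"
  assumes "\<alpha> > 0" and cw: "(c, w) \<in> Lambda_set \<alpha> \<union> Gamma_set"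
    and st: "s \<in> {-1<..<1}" "t \<in> {-1<..<1}" and w: "w $ 1 = of_real s" "w $ 2 = of_real t"
  shows "D \<alpha> c w = of_real (neg_information
    (real_kernel \<alpha> s s * (norm (c $ 1))\<^sup>2) (real_kernel \<alpha> t t * (norm (c $ 2))\<^sup>2)
    (real_kernel \<alpha> s t * c $ 1 * cnj (c $ 2)))"
proof -
  define a b k where "a = real_kernel \<alpha> s s" and "b = real_kernel \<alpha> t t" and "k = real_kernel \<alpha> s t"
  define c1 c2 where "c1 = c $ 1" and "c2 = c $ 2"
  define f1 f2 where "f1 = a * c1 + k * c2" and "f2 = k * c1 + b * c2"
  define z A B where "z = k * c1 * cnj c2" and "A = a * (norm c1)\<^sup>2" and "B = b * (norm c2)\<^sup>2"
  define N where "N = A + B + 2 * Re z"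
  have pos: "a > 0" "b > 0" "k > 0"
    using st by (auto simp: a_def b_def k_def real_kernel_pos)
  note info = neg_information_of_pair[OF pos f1_def f2_def z_def A_def B_def, folded N_def]
  have kc: "real_kernel \<alpha> t s = k" by (simp add: k_def real_kernel_commute)
  have f: "fvec \<alpha> c w $ 1 = f1" "fvec \<alpha> c w $ 2 = f2"
    using st by (simp_all add: fvec_def vector_matrix_mult_def kernel_matrix_def UNIV_2 w
        powr_eq_real_kernel f1_def f2_def a_def b_def kc c1_def c2_def flip: k_def)
  have sq: "complex_of_real A = a * (c1 * cnj c1)" "complex_of_real B = b * (c2 * cnj c2)"
    by (simp_all add: A_def B_def complex_norm_square del: of_real_power)
  have Nsum: "complex_of_real N = of_real A + of_real B + z + cnj z"
    unfolding N_def by (simp add: complex_eq_iff)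
  have "k\<^sup>2 \<le> a * b"
    unfolding a_def b_def k_def using \<open>\<alpha> > 0\<close> st by (rule real_kernel_Cauchy_Schwarz)
  then have disc: "(norm z)\<^sup>2 \<le> A * B"
    using mult_right_mono[of "k\<^sup>2" "a * b" "(norm c1)\<^sup>2 * (norm c2)\<^sup>2"]
    by (simp add: z_def A_def B_def norm_mult power_mult_distrib mult_ac)
  have "(Re z)\<^sup>2 \<le> (norm z)\<^sup>2" by (simp add: cmod_power2)
  then have "N \<ge> 0"
    unfolding N_def using disc pos by (intro geometric_mean_bound) (auto simp: A_def B_def)
  have "Nval \<alpha> c w = N"
    unfolding Nsum sq using st
    by (simp add: Nval_def UNIV_2 w powr_eq_real_kernel kc z_def algebra_simps
        flip: a_def b_def k_def c1_def c2_def)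
  then have NN: "Nval \<alpha> c w * Ln (Nval \<alpha> c w) = of_real (N * ln N)"
    using \<open>N \<ge> 0\<close> by (simp only: of_real_mult_Ln)
  have "D \<alpha> c w = of_real (neg_information A B z)"
  proof (cases "(c, w) \<in> Lambda_set \<alpha>")
    case True
    then have half: "Re f1 > 0" "Re f2 > 0"
      using f by (auto simp: Lambda_set_def right_half_plane_def forall_2)
    have cnj_log: "Ln (cnj f1) = cnj (Ln f1)" "Ln (cnj f2) = cnj (Ln f2)"
      using half by (auto simp: cnj_Ln complex_nonpos_Reals_iff)
    define u v where "u = cnj c1 * f1 * Ln f1" and "v = cnj c2 * f2 * Ln f2"
    have "D \<alpha> c w = D_Lambda \<alpha> c w" using True by (simp add: D_def)
    also have "\<dots> = (u + cnj u) + (v + cnj v) - A * ln a - B * ln b - (z + cnj z) * ln k - of_real (N * ln N)"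
      unfolding D_Lambda_def NN sq using st
      by (simp add: UNIV_2 w powr_eq_real_kernel Ln_eq_ln_real_kernel kc f cnj_log
          flip: a_def b_def k_def c1_def c2_def)
        (simp add: u_def v_def f1_def f2_def z_def sq algebra_simps)
    also have "\<dots> = of_real (2 * Re u + 2 * Re v - A * ln a - B * ln b - 2 * Re z * ln k - N * ln N)"
      by (simp add: complex_add_cnj)
    also have "\<dots> = of_real (neg_information A B z)"
    proof -
      have "cnj c1 * f1 = A + cnj z" "cnj c2 * f2 = B + z"
        unfolding sq by (simp_all add: f1_def f2_def z_def algebra_simps)
      moreover have "Ln f1 = ln (norm f1) + \<i> * Arg f1" "Ln f2 = ln (norm f2) + \<i> * Arg f2"
        using half by (metis Ln_Arg less_irrefl zero_complex.sel(1))+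
      ultimately have "Re u = (A + Re z) * ln (norm f1) + Im z * Arg f1"
        "Re v = (B + Re z) * ln (norm f2) - Im z * Arg f2"
        by (simp_all add: u_def v_def)
      moreover have "Im z * (Arg f1 - Arg f2) = Im z * (Arg z - Arg (A + z) - Arg (B + z))"
        unfolding A_def B_def using pos half
        by (intro Im_times_Arg_diff[OF _ _ _ f1_def f2_def _ _ z_def]) auto
      ultimately have "2 * Re u + 2 * Re v - A * ln a - B * ln b - 2 * Re z * ln k - N * ln N
          = neg_information A B z"
        unfolding info by (simp add: algebra_simps)
      then show ?thesis by (rule arg_cong)
    qed
    finally show ?thesis .
  next
    case False
    then have "(c, w) \<in> Gamma_set" using cw by simp
    then have "c1 \<in> \<real>" "c2 \<in> \<real>" by (simp_all add: Gamma_set_def c1_def c2_def)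
    then obtain r1 r2 where r: "c1 = of_real r1" "c2 = of_real r2"
      by (metis Reals_cases)
    define g1 g2 where "g1 = a * r1 + k * r2" and "g2 = k * r1 + b * r2"
    have g: "f1 = of_real g1" "f2 = of_real g2" by (simp_all add: f1_def f2_def g1_def g2_def r)
    have z: "z = of_real (k * r1 * r2)" by (simp add: z_def r)
    \<comment> \<open>the case \<open>x = 0\<close> is the convention \<open>0 Log 0 = 0\<close> for vanishing \<open>f1\<close> or \<open>f2\<close>\<close>
    have Ln_abs: "u * of_real x * Ln (of_real \<bar>x\<bar>) = u * of_real (x * ln \<bar>x\<bar>)" for u and x :: real
      by (cases "x = 0") (simp_all add: Ln_of_real)
    have "D \<alpha> c w = D_Gamma \<alpha> c w" using False by (simp add: D_def)
    also have "\<dots> = of_real (2 * (r1 * g1) * ln \<bar>g1\<bar> + 2 * (r2 * g2) * ln \<bar>g2\<bar>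
       - A * ln a - B * ln b - 2 * (k * r1 * r2) * ln k - N * ln N)"
      unfolding D_Gamma_def NN using st
      by (simp add: UNIV_2 w powr_eq_real_kernel Ln_one_divide_of_real pos kc f g Ln_abs
          flip: a_def b_def k_def c1_def c2_def)
        (simp add: r A_def B_def power2_eq_square algebra_simps)
    also have "\<dots> = of_real (neg_information A B z)"
    proof -
      have "r1 * g1 = A + Re z" "r2 * g2 = B + Re z"
        by (simp_all add: A_def B_def z r g1_def g2_def power2_eq_square algebra_simps)
      then show ?thesis unfolding info by (simp add: z g)
    qed
    finally show ?thesis .
  qed
  then show ?thesis
    by (simp add: A_def B_def z_def a_def b_def k_def c1_def c2_def)
qed

theorem theorem3p8:
  fixes \<alpha> :: real and c w :: "complex ^ 2"
  assumes "\<alpha> > 0"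
    and "\<forall>i. w $ i \<in> ball 0 1"
    and "(c, w) \<in> Lambda_set \<alpha> \<union> Gamma_set"
  shows "D \<alpha> c w \<le> 0 \<and> (D \<alpha> c w = 0 \<longleftrightarrow> c $ 1 = 0 \<or> c $ 2 = 0 \<or> w $ 1 = w $ 2)"
proof -
  have "\<forall>i. w $ i \<in> of_real ` {-1<..<1}"
    using assms(3) by (auto simp: Lambda_set_def Gamma_set_def)
  then obtain s t where st: "s \<in> {-1<..<1}" "t \<in> {-1<..<1}"
    and w: "w $ 1 = of_real s" "w $ 2 = of_real t"
    unfolding forall_2 by blast
  define a b k where "a = real_kernel \<alpha> s s" and "b = real_kernel \<alpha> t t" and "k = real_kernel \<alpha> s t"
  define A B z where "A = a * (norm (c $ 1))\<^sup>2" and "B = b * (norm (c $ 2))\<^sup>2"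
    and "z = k * c $ 1 * cnj (c $ 2)"
  define m where "m = (norm (c $ 1))\<^sup>2 * (norm (c $ 2))\<^sup>2"
  have AB: "A \<ge> 0" "B \<ge> 0"
    using st by (simp_all add: A_def B_def a_def b_def less_imp_le real_kernel_pos)
  have CS: "k\<^sup>2 \<le> a * b" "k\<^sup>2 = a * b \<longleftrightarrow> s = t"
    unfolding a_def b_def k_def using real_kernel_Cauchy_Schwarz[OF assms(1) st] by blast+
  have z2: "(norm z)\<^sup>2 = k\<^sup>2 * m" and AB2: "A * B = a * b * m"
    by (simp_all add: z_def A_def B_def m_def norm_mult power_mult_distrib)
  have disc: "(norm z)\<^sup>2 \<le> A * B"
    unfolding z2 AB2 using CS by (intro mult_right_mono) (simp_all add: m_def)
  have crit: "(norm z)\<^sup>2 = A * B \<longleftrightarrow> c $ 1 = 0 \<or> c $ 2 = 0 \<or> w $ 1 = w $ 2"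
    unfolding z2 AB2 mult_cancel_right CS by (auto simp: m_def w)
  have "D \<alpha> c w = of_real (neg_information A B z)"
    using D_eq_neg_information[OF assms(1,3) st w]
    by (simp add: A_def B_def z_def a_def b_def k_def)
  moreover note neg_information_sign[OF AB disc] crit
  ultimately show ?thesis by (simp add: less_eq_complex_def)
qed

end
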